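(* Let $\mathcal L_1$ and $\mathcal L_2$ be simple closure spaces on $\Sigma_1$ and $\Sigma_2$ respectively. Then: (1) $\mathcal L_1\,\overline{\otimes}\,\mathcal L_2\cong\mathcal L_1\otimes_{\mathrm{Chu}}\mathcal L_2$ (isomorphism in the category $\mathbf{Chu}(\mathbf{Set},2)$). (2) The dual lattice $(\mathcal L_1\,\overline{\otimes}\,\mathcal L_2)^*$ is isomorphic to the set of maps $\mathcal L_1\to\mathcal L_2^*$ preserving arbitrary joins, ordered point-wise, i.e. $f\le g$ if and only if $f(p_1)\le_* g(p_1)$ for all $p_1\in\Sigma_1$.
   Context: A simple closure space on a nonempty set $\Sigma$ is a set $\mathcal L\subseteq 2^\Sigma$, ordered by inclusion, closed under arbitrary intersections and containing $\Sigma$, $\emptyset$ and all singletons. It is a complete atomistic lattice whose atoms are the singletons; $p\in\Sigma$ is identified with $\{p\}$. For a poset $\mathcal L$, $\mathcal L^*$ is the dual poset and $\le_*$ its order (the converse order). $\mathcal L_1\,\overline{\otimes}\,\mathcal L_2$ is the simple closure space on $\Sigma_1\times\Sigma_2$ consisting of all $R\subseteq\Sigma_1\times\Sigma_2$ such that $\{q_2\in\Sigma_2:(p_1,q_2)\in R\}\in\mathcal L_2$ for all $p_1\in\Sigma_1$ and $\{q_1\in\Sigma_1:(q_1,p_2)\in R\}\in\mathcal L_1$ for all $p_2\in\Sigma_2$. The category $\mathbf{Chu}(\mathbf{Set},2)$, $2=\{0,1\}$, has as objects triples $\mathsf A=(A,r,X)$ with $A,X$ sets and $r:A\times X\to 2$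 a map; arrows $(A,r,X)\to(B,s,Y)$ are pairs $(F,G)$ with $F:A\to B$, $G:Y\to X$ such that $s(F(a),y)=r(a,G(y))$ for all $a\in A$, $y\in Y$. Put $\mathsf A^\perp=(X,\check r,A)$ with $\check r(x,a)=r(a,x)$, and for $\mathsf A=(A,r,X)$, $\mathsf B=(B,s,Y)$ put $\mathsf A\otimes_{\mathrm{Chu}}\mathsf B=(A\times B,t,\mathbf{Chu}(\mathsf A,\mathsf B^\perp))$, where $\mathbf{Chu}(\mathsf A,\mathsf B^\perp)$ is the set of arrows $\mathsf A\to\mathsf B^\perp$ and $t((a,b),(F,G))=r(a,G(b))=\check s(F(a),b)$. A simple closure space $\mathcal L$ on $\Sigma$ is identified with the Chu space $(\Sigma,r,\mathcal L)$, where $r(p,a)=1$ iff $p\in a$. *)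

theory Defs
  imports "HOL-Library.FuncSet" "HOL-Algebra.Complete_Lattice"
begin

text \<open>Closure under arbitrary intersections is stated for nonempty families; the intersection of
  the empty family of subsets of \<open>S\<close> is \<open>S\<close> itself, which is covered by \<open>space_closed\<close>.\<close>

locale simple_closure_space =
  fixes S :: "'a set" and L :: "'a set set"
  assumes nonempty: "S \<noteq> {}"
    and subsets: "L \<subseteq> Pow S"
    and space_closed: "S \<in> L"
    and empty_closed: "{} \<in> L"
    and singleton_closed: "\<And>p. p \<in> S \<Longrightarrow> {p} \<in> L"
    and Inter_closed: "\<And>\<A>. \<A> \<subseteq> L \<Longrightarrow> \<A> \<noteq> {} \<Longrightarrow> \<Inter>\<A> \<in> L"

definition closure_order :: "'a set set \<Rightarrow> 'a set gorder" where
  "closure_order L = \<lparr>carrier = L, eq = (=), le = (\<subseteq>)\<rparr>"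

definition closure_tensor ::
    "'a set \<Rightarrow> 'a set set \<Rightarrow> 'b set \<Rightarrow> 'b set set \<Rightarrow> ('a \<times> 'b) set set" where
  "closure_tensor S1 L1 S2 L2 =
     {R. R \<subseteq> S1 \<times> S2 \<and>
         (\<forall>p1\<in>S1. {q2 \<in> S2. (p1, q2) \<in> R} \<in> L2) \<and>
         (\<forall>p2\<in>S2. {q1 \<in> S1. (q1, p2) \<in> R} \<in> L1)}"

text \<open>Chu spaces over \<open>2\<close>, with \<^typ>\<open>bool\<close> as the two-element set. The values of
  \<open>chu_rel A\<close> outside \<open>chu_pts A \<times> chu_sts A\<close> carry no meaning: arrows only refer to values
  on the carriers.\<close>

record ('a, 'x) chu =
  chu_pts :: "'a set"
  chu_rel :: "'a \<Rightarrow> 'x \<Rightarrow> bool"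
  chu_sts :: "'x set"

text \<open>Arrows are pairs of extensional functions, so that equality of arrows is equality of maps
  on the given sets.\<close>

definition chu_hom :: "('a, 'x) chu \<Rightarrow> ('b, 'y) chu \<Rightarrow> (('a \<Rightarrow> 'b) \<times> ('y \<Rightarrow> 'x)) set" where
  "chu_hom A B =
     {(F, G). F \<in> chu_pts A \<rightarrow>\<^sub>E chu_pts B \<and> G \<in> chu_sts B \<rightarrow>\<^sub>E chu_sts A \<and>
        (\<forall>a\<in>chu_pts A. \<forall>y\<in>chu_sts B. chu_rel B (F a) y \<longleftrightarrow> chu_rel A a (G y))}"

definition chu_id :: "('a, 'x) chu \<Rightarrow> ('a \<Rightarrow> 'a) \<times> ('x \<Rightarrow> 'x)" where
  "chu_id A = (\<lambda>a\<in>chu_pts A. a, \<lambda>x\<in>chu_sts A. x)"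

text \<open>\<open>chu_comp A C g f\<close> is \<open>g\<close> after \<open>f\<close>, where \<open>f\<close> has domain \<open>A\<close> and \<open>g\<close> has codomain \<open>C\<close>;
  the backward components compose in the opposite order.\<close>

definition chu_comp :: "('a, 'x) chu \<Rightarrow> ('c, 'z) chu \<Rightarrow>
    ('b \<Rightarrow> 'c) \<times> ('z \<Rightarrow> 'y) \<Rightarrow> ('a \<Rightarrow> 'b) \<times> ('y \<Rightarrow> 'x) \<Rightarrow> ('a \<Rightarrow> 'c) \<times> ('z \<Rightarrow> 'x)" where
  "chu_comp A C g f =
     (compose (chu_pts A) (fst g) (fst f), compose (chu_sts C) (snd f) (snd g))"

definition chu_isomorphic :: "('a, 'x) chu \<Rightarrow> ('b, 'y) chu \<Rightarrow> bool" where
  "chu_isomorphic A B \<longleftrightarrow>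
     (\<exists>f\<in>chu_hom A B. \<exists>g\<in>chu_hom B A.
        chu_comp A A g f = chu_id A \<and> chu_comp B B f g = chu_id B)"

definition chu_dual :: "('a, 'x) chu \<Rightarrow> ('x, 'a) chu" where
  "chu_dual A =
     \<lparr>chu_pts = chu_sts A, chu_rel = (\<lambda>x a. chu_rel A a x), chu_sts = chu_pts A\<rparr>"

definition chu_tensor ::
    "('a, 'x) chu \<Rightarrow> ('b, 'y) chu \<Rightarrow> ('a \<times> 'b, ('a \<Rightarrow> 'y) \<times> ('b \<Rightarrow> 'x)) chu" where
  "chu_tensor A B =
     \<lparr>chu_pts = chu_pts A \<times> chu_pts B,
      chu_rel = (\<lambda>(a, b) (F, G). chu_rel A a (G b)),
      chu_sts = chu_hom A (chu_dual B)\<rparr>"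

definition closure_chu :: "'a set \<Rightarrow> 'a set set \<Rightarrow> ('a, 'a set) chu" where
  "closure_chu S L = \<lparr>chu_pts = S, chu_rel = (\<in>), chu_sts = L\<rparr>"

definition order_isomorphic :: "('a, 'c) gorder_scheme \<Rightarrow> ('b, 'd) gorder_scheme \<Rightarrow> bool" where
  "order_isomorphic X Y \<longleftrightarrow>
     (\<exists>h. bij_betw h (carrier X) (carrier Y) \<and> order_emb X Y h)"

text \<open>The maps from \<open>L1\<close> (a simple closure space on \<open>S1\<close>) to \<open>Y\<close> that preserve all joins, the
  empty one included, compared on the atoms \<open>{p}\<close> of \<open>L1\<close>.\<close>

definition join_map_order ::
    "'a set \<Rightarrow> 'a set set \<Rightarrow> ('b, 'c) gorder_scheme \<Rightarrow> ('a set \<Rightarrow> 'b) gorder" where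
  "join_map_order S1 L1 Y =
     \<lparr>carrier = {f \<in> L1 \<rightarrow>\<^sub>E carrier Y. sup_pres (closure_order L1) Y f},
      eq = (=),
      le = (\<lambda>f g. \<forall>p\<in>S1. f {p} \<sqsubseteq>\<^bsub>Y\<^esub> g {p})\<rparr>"

lemma (in simple_closure_space) complete_lattice_closure_order:
  "complete_lattice (closure_order L)"
proof -
  interpret partial_order "closure_order L"
    by unfold_locales (auto simp: closure_order_def)
  show ?thesis
  proof (rule complete_latticeI)
    fix A assume A: "A \<subseteq> carrier (closure_order L)"
    let ?U = "{u \<in> L. \<Union>A \<subseteq> u}"
    have "S \<in> ?U"
      using A subsets space_closed by (auto simp: closure_order_def)
    then have "\<Inter>?U \<in> L"
      by (intro Inter_closed) auto
    then have "least (closure_order L) (\<Inter>?U) (Upper (closure_order L) A)"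
      using A by (auto simp: least_def Upper_def closure_order_def)
    then show "\<exists>s. least (closure_order L) s (Upper (closure_order L) A)" ..
  next
    fix A assume A: "A \<subseteq> carrier (closure_order L)"
    let ?I = "S \<inter> \<Inter>A"
    have "?I = \<Inter>(insert S A)"
      by simp
    moreover have "\<Inter>(insert S A) \<in> L"
      using A space_closed by (intro Inter_closed) (auto simp: closure_order_def)
    ultimately have "?I \<in> L"
      by simp
    then have "greatest (closure_order L) ?I (Lower (closure_order L) A)"
      using A subsets by (auto simp: greatest_def Lower_def closure_order_def)
    then show "\<exists>i. greatest (closure_order L) i (Lower (closure_order L) A)" ..
  qed
qed

lemma simple_closure_space_closure_tensor:
  assumes "simple_closure_space S1 L1" and "simple_closure_space S2 L2"
  shows "simple_closure_space (S1 \<times> S2) (closure_tensor S1 L1 S2 L2)"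
proof -
  interpret A: simple_closure_space S1 L1 by fact
  interpret B: simple_closure_space S2 L2 by fact
  show ?thesis
  proof
    show "S1 \<times> S2 \<noteq> {}"
      using A.nonempty B.nonempty by auto
    show "closure_tensor S1 L1 S2 L2 \<subseteq> Pow (S1 \<times> S2)"
      by (auto simp: closure_tensor_def)
    show "S1 \<times> S2 \<in> closure_tensor S1 L1 S2 L2"
      by (simp add: closure_tensor_def A.space_closed B.space_closed)
    show "{} \<in> closure_tensor S1 L1 S2 L2"
      by (simp add: closure_tensor_def A.empty_closed B.empty_closed)
  next
    fix p assume p: "p \<in> S1 \<times> S2"
    have "{q2 \<in> S2. (p1, q2) \<in> {p}} = (if p1 = fst p then {snd p} else {})" for p1
      using p by auto
    moreover have "{q1 \<in> S1. (q1, p2) \<in> {p}} = (if p2 = snd p then {fst p} else {})" for p2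
      using p by auto
    ultimately show "{p} \<in> closure_tensor S1 L1 S2 L2"
      using p by (auto simp: closure_tensor_def A.empty_closed B.empty_closed
          A.singleton_closed B.singleton_closed)
  next
    fix \<A> assume sub: "\<A> \<subseteq> closure_tensor S1 L1 S2 L2" and ne: "\<A> \<noteq> {}"
    have "{q2 \<in> S2. (p1, q2) \<in> \<Inter>\<A>} \<in> L2" if "p1 \<in> S1" for p1
    proof -
      have "{q2 \<in> S2. (p1, q2) \<in> \<Inter>\<A>} = \<Inter>((\<lambda>R. {q2 \<in> S2. (p1, q2) \<in> R}) ` \<A>)"
        using ne by auto
      also have "\<dots> \<in> L2"
        using sub ne that by (intro B.Inter_closed) (auto simp: closure_tensor_def)
      finally show ?thesis .
    qed
    moreover have "{q1 \<in> S1. (q1, p2) \<in> \<Inter>\<A>} \<in> L1" if "p2 \<in> S2" for p2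
    proof -
      have "{q1 \<in> S1. (q1, p2) \<in> \<Inter>\<A>} = \<Inter>((\<lambda>R. {q1 \<in> S1. (q1, p2) \<in> R}) ` \<A>)"
        using ne by auto
      also have "\<dots> \<in> L1"
        using sub ne that by (intro A.Inter_closed) (auto simp: closure_tensor_def)
      finally show ?thesis .
    qed
    moreover have "\<Inter>\<A> \<subseteq> S1 \<times> S2"
      using sub ne unfolding closure_tensor_def by blast
    ultimately show "\<Inter>\<A> \<in> closure_tensor S1 L1 S2 L2"
      by (simp add: closure_tensor_def)
  qed
qed

end

theory Submission
  imports Defs
begin

text \<open>
  All three objects of the theorem encode the same data, a relation \<open>R \<subseteq> S1 \<times> S2\<close> whose rows are
  closed in the second space and whose columns are closed in the first one.

  An arrow \<open>(F, G)\<close> from the first Chu space to the dual of the second satisfies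
  \<open>q \<in> F p \<longleftrightarrow> p \<in> G q\<close>. So \<open>F\<close> and \<open>G\<close> are nothing but the row map and the column map of one
  relation, and that \<open>F\<close> and \<open>G\<close> take closed sets as values is the defining condition of the tensor
  product. The points of the two Chu spaces agree, so this bijection between their states is an
  isomorphism.

  For the dual lattice, a relation \<open>R\<close> is sent to its polar map
  \<open>a \<mapsto> {q. a \<times> {q} \<subseteq> R}\<close>. It takes closed values because it intersects rows of \<open>R\<close>. Joins in the
  dual of the second lattice are intersections, and the polar map turns unions into intersections;
  it turns joins into intersections because a closed column contains a union as soon as it
  contains all the members, and then also contains the closure of that union. Conversely, a
  closed set is the join of its atoms, so a join preserving map \<open>f\<close> is determined by its values on
  atoms and is the polar map of the relation with rows \<open>f {p}\<close>. The columns of that relation are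
  closed because \<open>q \<in> f {p}\<close> for all \<open>p\<close> in a set implies the same for all \<open>p\<close> in its closure. As
  the value of the polar map at an atom is a row of \<open>R\<close>, comparing maps on atoms amounts to
  comparing relations. The lemmas \<open>bij_betw_chu_hom_closure_tensor\<close> and \<open>bij_betw_polar_map\<close>
  carry the two halves.
\<close>

section \<open>Rows and columns of closed relations\<close>

lemma closure_tensor_iff:
  "R \<in> closure_tensor S1 L1 S2 L2 \<longleftrightarrow>
     R \<subseteq> S1 \<times> S2 \<and> (\<forall>p\<in>S1. R `` {p} \<in> L2) \<and> (\<forall>q\<in>S2. R\<inverse> `` {q} \<in> L1)"
proof (cases "R \<subseteq> S1 \<times> S2")
  case True
  then have "{q \<in> S2. (p, q) \<in> R} = R `` {p}" "{p \<in> S1. (p, q) \<in> R} = R\<inverse> `` {q}" for p q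
    by auto
  with True show ?thesis
    by (simp add: closure_tensor_def)
qed (simp add: closure_tensor_def)

section \<open>The Chu tensor product\<close>

text \<open>The identity on points, paired with a bijection between the states in one direction and its
  inverse in the other, gives two mutually inverse arrows.\<close>

lemma chu_isomorphic_same_points:
  assumes pts: "chu_pts A = chu_pts B"
    and bij: "bij_betw \<phi> (chu_sts B) (chu_sts A)"
    and rel: "\<And>a y. a \<in> chu_pts A \<Longrightarrow> y \<in> chu_sts B \<Longrightarrow> chu_rel B a y \<longleftrightarrow> chu_rel A a (\<phi> y)"
  shows "chu_isomorphic A B"
proof -
  define \<psi> where "\<psi> = inv_into (chu_sts B) \<phi>"
  have \<phi>: "\<phi> y \<in> chu_sts A" "\<psi> (\<phi> y) = y" if "y \<in> chu_sts B" for y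
    using bij that by (auto simp: \<psi>_def bij_betw_def)
  have \<psi>: "\<psi> x \<in> chu_sts B" "\<phi> (\<psi> x) = x" if "x \<in> chu_sts A" for x
    using bij that by (auto simp: \<psi>_def bij_betw_def inv_into_into f_inv_into_f)
  let ?id = "\<lambda>a\<in>chu_pts A. a"
  let ?f = "(?id, restrict \<phi> (chu_sts B))" and ?g = "(?id, restrict \<psi> (chu_sts A))"
  have "?f \<in> chu_hom A B" "?g \<in> chu_hom B A"
    using pts rel \<phi> \<psi> by (auto simp: chu_hom_def)
  moreover have "chu_comp A A ?g ?f = chu_id A" "chu_comp B B ?f ?g = chu_id B"
    using pts \<phi> \<psi> by (auto simp: chu_comp_def chu_id_def compose_def fun_eq_iff)
  ultimately show ?thesis
    unfolding chu_isomorphic_def by blast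
qed

lemma chu_hom_to_dual_iff:
  "(F, G) \<in> chu_hom (closure_chu S1 L1) (chu_dual (closure_chu S2 L2)) \<longleftrightarrow>
     F \<in> S1 \<rightarrow>\<^sub>E L2 \<and> G \<in> S2 \<rightarrow>\<^sub>E L1 \<and> (\<forall>p\<in>S1. \<forall>q\<in>S2. q \<in> F p \<longleftrightarrow> p \<in> G q)"
  by (simp add: chu_hom_def closure_chu_def chu_dual_def)

text \<open>The closed relation of an arrow \<open>(F, G)\<close> has the values of \<open>F\<close> as rows; the adjointness
  condition says exactly that its columns are then the values of \<open>G\<close>.\<close>

lemma bij_betw_chu_hom_closure_tensor:
  assumes "L1 \<subseteq> Pow S1" and "L2 \<subseteq> Pow S2"
  shows "bij_betw (\<lambda>(F, G). Sigma S1 F)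
           (chu_hom (closure_chu S1 L1) (chu_dual (closure_chu S2 L2)))
           (closure_tensor S1 L1 S2 L2)"
    (is "bij_betw _ ?H ?T")
proof (rule bij_betw_byWitness
    [where f' = "\<lambda>R. (\<lambda>p\<in>S1. R `` {p}, \<lambda>q\<in>S2. R\<inverse> `` {q})"])
  show "\<forall>h\<in>?H. (\<lambda>R. (\<lambda>p\<in>S1. R `` {p}, \<lambda>q\<in>S2. R\<inverse> `` {q})) ((\<lambda>(F, G). Sigma S1 F) h) = h"
  proof
    fix h assume "h \<in> ?H"
    moreover obtain F G where FG: "h = (F, G)"
      by (cases h)
    ultimately have h: "(F, G) \<in> ?H"
      by simp
    then have maps: "F \<in> S1 \<rightarrow>\<^sub>E L2" "G \<in> S2 \<rightarrow>\<^sub>E L1"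
      by (simp_all add: chu_hom_to_dual_iff)
    have "(\<lambda>p\<in>S1. Sigma S1 F `` {p}) = F"
      using maps(1) by (intro ext) (auto simp: restrict_def PiE_arb[OF maps(1)])
    moreover have "(\<lambda>q\<in>S2. (Sigma S1 F)\<inverse> `` {q}) = G"
    proof
      fix q show "(\<lambda>q\<in>S2. (Sigma S1 F)\<inverse> `` {q}) q = G q"
      proof (cases "q \<in> S2")
        case True
        then have "G q \<subseteq> S1" and "\<forall>p\<in>S1. q \<in> F p \<longleftrightarrow> p \<in> G q"
          using h assms(1) by (auto simp: chu_hom_to_dual_iff)
        with True show ?thesis
          by auto
      qed (simp add: PiE_arb[OF maps(2)])
    qed
    ultimately show "(\<lambda>R. (\<lambda>p\<in>S1. R `` {p}, \<lambda>q\<in>S2. R\<inverse> `` {q})) ((\<lambda>(F, G). Sigma S1 F) h) = h"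
      by (simp add: FG)
  qed
  show "\<forall>R\<in>?T. (\<lambda>(F, G). Sigma S1 F) (\<lambda>p\<in>S1. R `` {p}, \<lambda>q\<in>S2. R\<inverse> `` {q}) = R"
    by (auto simp: closure_tensor_iff)
  show "(\<lambda>(F, G). Sigma S1 F) ` ?H \<subseteq> ?T"
  proof clarify
    fix F G assume h: "(F, G) \<in> ?H"
    have "Sigma S1 F `` {p} = F p" if "p \<in> S1" for p
      using that by auto
    moreover have "(Sigma S1 F)\<inverse> `` {q} = G q" if "q \<in> S2" for q
    proof -
      have "G q \<subseteq> S1" and "\<forall>p\<in>S1. q \<in> F p \<longleftrightarrow> p \<in> G q"
        using h assms(1) that by (auto simp: chu_hom_to_dual_iff)
      then show ?thesis by auto
    qed
    moreover have "Sigma S1 F \<subseteq> S1 \<times> S2"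
      using h assms(2) by (auto simp: chu_hom_to_dual_iff)
    ultimately show "Sigma S1 F \<in> ?T"
      using h by (auto simp: closure_tensor_iff chu_hom_to_dual_iff)
  qed
  show "(\<lambda>R. (\<lambda>p\<in>S1. R `` {p}, \<lambda>q\<in>S2. R\<inverse> `` {q})) ` ?T \<subseteq> ?H"
    by (auto simp: closure_tensor_iff chu_hom_to_dual_iff)
qed

proposition chu_isomorphic_closure_tensor:
  assumes "L1 \<subseteq> Pow S1" and "L2 \<subseteq> Pow S2"
  shows "chu_isomorphic (closure_chu (S1 \<times> S2) (closure_tensor S1 L1 S2 L2))
           (chu_tensor (closure_chu S1 L1) (closure_chu S2 L2))"
proof (rule chu_isomorphic_same_points)
  show "bij_betw (\<lambda>(F, G). Sigma S1 F)
      (chu_sts (chu_tensor (closure_chu S1 L1) (closure_chu S2 L2)))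
      (chu_sts (closure_chu (S1 \<times> S2) (closure_tensor S1 L1 S2 L2)))"
    using bij_betw_chu_hom_closure_tensor[OF assms] by (simp add: chu_tensor_def closure_chu_def)
next
  fix pq FG
  assume "pq \<in> chu_pts (closure_chu (S1 \<times> S2) (closure_tensor S1 L1 S2 L2))"
    and "FG \<in> chu_sts (chu_tensor (closure_chu S1 L1) (closure_chu S2 L2))"
  then obtain p q F G where "pq = (p, q)" "FG = (F, G)" "p \<in> S1" "q \<in> S2"
    and "(F, G) \<in> chu_hom (closure_chu S1 L1) (chu_dual (closure_chu S2 L2))"
    by (cases pq; cases FG) (auto simp: closure_chu_def[of "S1 \<times> S2"] chu_tensor_def)
  then show "chu_rel (chu_tensor (closure_chu S1 L1) (closure_chu S2 L2)) pq FG \<longleftrightarrow>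
      chu_rel (closure_chu (S1 \<times> S2) (closure_tensor S1 L1 S2 L2)) pq ((\<lambda>(F, G). Sigma S1 F) FG)"
    by (simp add: chu_hom_to_dual_iff) (simp add: chu_tensor_def closure_chu_def)
qed (simp add: chu_tensor_def closure_chu_def)

section \<open>Joins of closed sets\<close>

definition (in simple_closure_space) hull_of :: "'a set \<Rightarrow> 'a set" where
  "hull_of a = \<Inter>{u \<in> L. a \<subseteq> u}"

context simple_closure_space
begin

lemma closed_Int_Inter:
  assumes "\<A> \<subseteq> L"
  shows "S \<inter> \<Inter>\<A> \<in> L"
proof -
  have "\<Inter>(insert S \<A>) \<in> L"
    using assms space_closed by (intro Inter_closed) auto
  then show ?thesis by simp
qed

lemma hull_of_closed: "a \<subseteq> S \<Longrightarrow> hull_of a \<in> L"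
  unfolding hull_of_def using space_closed by (intro Inter_closed) auto

lemma hull_of_superset: "a \<subseteq> hull_of a"
  by (auto simp: hull_of_def)

lemma hull_of_subset_iff: "u \<in> L \<Longrightarrow> hull_of a \<subseteq> u \<longleftrightarrow> a \<subseteq> u"
  by (auto simp: hull_of_def)

lemma hull_of_eq: "a \<in> L \<Longrightarrow> hull_of a = a"
  using hull_of_subset_iff[of a a] hull_of_superset[of a] by blast

lemma sup_closure_order:
  assumes "\<A> \<subseteq> L"
  shows "\<Squnion>\<^bsub>closure_order L\<^esub> \<A> = hull_of (\<Union>\<A>)"
proof -
  interpret complete_lattice "closure_order L"
    by (rule complete_lattice_closure_order)
  have closed: "hull_of (\<Union>\<A>) \<in> L"
    using assms subsets by (intro hull_of_closed) auto
  have "least (closure_order L) (hull_of (\<Union>\<A>)) (Upper (closure_order L) \<A>)"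
  proof (rule least_UpperI)
    show "a \<sqsubseteq>\<^bsub>closure_order L\<^esub> hull_of (\<Union>\<A>)" if "a \<in> \<A>" for a
      using that hull_of_superset[of "\<Union>\<A>"] by (auto simp: closure_order_def)
    show "hull_of (\<Union>\<A>) \<sqsubseteq>\<^bsub>closure_order L\<^esub> u" if "u \<in> Upper (closure_order L) \<A>" for u
      using that assms
      by (simp add: Upper_def closure_order_def hull_of_subset_iff) blast
  qed (use assms closed in \<open>simp_all add: closure_order_def\<close>)
  moreover have "least (closure_order L) (\<Squnion>\<^bsub>closure_order L\<^esub> \<A>) (Upper (closure_order L) \<A>)"
    using assms by (intro sup_lub) (simp add: closure_order_def)
  ultimately show ?thesis
    by (rule least_unique[symmetric])
qed

lemma inf_closure_order:
  assumes "\<A> \<subseteq> L"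
  shows "\<Sqinter>\<^bsub>closure_order L\<^esub> \<A> = S \<inter> \<Inter>\<A>"
proof -
  interpret complete_lattice "closure_order L"
    by (rule complete_lattice_closure_order)
  have "greatest (closure_order L) (S \<inter> \<Inter>\<A>) (Lower (closure_order L) \<A>)"
    using assms subsets closed_Int_Inter[OF assms]
    by (auto simp: greatest_def Lower_def closure_order_def)
  moreover have "greatest (closure_order L) (\<Sqinter>\<^bsub>closure_order L\<^esub> \<A>) (Lower (closure_order L) \<A>)"
    using assms by (intro inf_glb) (simp add: closure_order_def)
  ultimately show ?thesis
    by (rule greatest_unique[symmetric])
qed

lemma complete_lattice_inv_closure_order: "complete_lattice (inv_gorder (closure_order L))"
proof -
  interpret complete_lattice "closure_order L"
    by (rule complete_lattice_closure_order)
  interpret dual: partial_order "inv_gorder (closure_order L)"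
    by (rule dual_order)
  show ?thesis
    by (rule dual.complete_latticeI) (use sup_exists inf_exists in simp_all)
qed

end

section \<open>Join preserving maps as closed relations\<close>

text \<open>Joins in the first lattice are closures of unions, and in the dual of the second lattice
  joins are intersections. The factor \<open>S2\<close> is the
  intersection of the empty family, hence the value at the empty join.\<close>

lemma carrier_join_map_order_iff:
  assumes A: "simple_closure_space S1 L1" and B: "simple_closure_space S2 L2"
  shows "f \<in> carrier (join_map_order S1 L1 (inv_gorder (closure_order L2))) \<longleftrightarrow>
    f \<in> L1 \<rightarrow>\<^sub>E L2 \<and>
    (\<forall>\<A>\<subseteq>L1. f (simple_closure_space.hull_of L1 (\<Union>\<A>)) = S2 \<inter> (\<Inter>a\<in>\<A>. f a))"
proof -
  interpret A: simple_closure_space S1 L1 by (rule A)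
  interpret B: simple_closure_space S2 L2 by (rule B)
  have "\<Squnion>\<^bsub>inv_gorder (closure_order L2)\<^esub> (f ` \<A>) = S2 \<inter> (\<Inter>a\<in>\<A>. f a)"
    if "f \<in> L1 \<rightarrow>\<^sub>E L2" "\<A> \<subseteq> L1" for \<A>
    using that by (subst sup_dual, subst B.inf_closure_order) auto
  moreover have "f \<in> carrier (join_map_order S1 L1 (inv_gorder (closure_order L2))) \<longleftrightarrow>
      f \<in> L1 \<rightarrow>\<^sub>E L2 \<and>
      (\<forall>\<A>\<subseteq>L1. f (\<Squnion>\<^bsub>closure_order L1\<^esub> \<A>) = \<Squnion>\<^bsub>inv_gorder (closure_order L2)\<^esub> (f ` \<A>))"
    using A.complete_lattice_closure_order B.complete_lattice_inv_closure_order
    by (simp add: join_map_order_def sup_pres_def closure_order_def del: sup_dual)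
  ultimately show ?thesis
    by (auto simp: A.sup_closure_order simp del: sup_dual)
qed

text \<open>The polarity of a relation in the sense of Galois connections, restricted to closed sets.\<close>

definition polar_map :: "'a set set \<Rightarrow> 'b set \<Rightarrow> ('a \<times> 'b) set \<Rightarrow> 'a set \<Rightarrow> 'b set" where
  "polar_map L1 S2 R = (\<lambda>a\<in>L1. {q \<in> S2. a \<subseteq> R\<inverse> `` {q}})"

definition atom_relation :: "'a set \<Rightarrow> ('a set \<Rightarrow> 'b set) \<Rightarrow> ('a \<times> 'b) set" where
  "atom_relation S1 f = Sigma S1 (\<lambda>p. f {p})"

context
  fixes S1 :: "'a set" and L1 :: "'a set set" and S2 :: "'b set" and L2 :: "'b set set"
  assumes spaces: "simple_closure_space S1 L1" "simple_closure_space S2 L2"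
begin

interpretation A: simple_closure_space S1 L1 by (rule spaces)
interpretation B: simple_closure_space S2 L2 by (rule spaces)

abbreviation (input) tensor where "tensor \<equiv> closure_tensor S1 L1 S2 L2"
abbreviation (input) join_maps where
  "join_maps \<equiv> join_map_order S1 L1 (inv_gorder (closure_order L2))"

lemma polar_map_atom:
  assumes "R \<in> tensor" "p \<in> S1"
  shows "polar_map L1 S2 R {p} = R `` {p}"
  using assms A.singleton_closed by (auto simp: polar_map_def closure_tensor_iff)

text \<open>Closed columns make the condition \<open>a \<subseteq> R\<inverse> `` {q}\<close> insensitive to replacing a union
  by its closure.\<close>

lemma polar_map_in_join_maps:
  assumes R: "R \<in> tensor"
  shows "polar_map L1 S2 R \<in> carrier join_maps"
  unfolding carrier_join_map_order_iff[OF spaces]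
proof (intro conjI allI impI)
  have "{q \<in> S2. a \<subseteq> R\<inverse> `` {q}} \<in> L2" if "a \<in> L1" for a
  proof -
    have "{q \<in> S2. a \<subseteq> R\<inverse> `` {q}} = S2 \<inter> (\<Inter>p\<in>a. R `` {p})"
      by auto
    also have "\<dots> \<in> L2"
      using R A.subsets that by (intro B.closed_Int_Inter) (auto simp: closure_tensor_iff)
    finally show ?thesis .
  qed
  then show "polar_map L1 S2 R \<in> L1 \<rightarrow>\<^sub>E L2"
    by (simp add: polar_map_def)
next
  fix \<A> assume \<A>: "\<A> \<subseteq> L1"
  then have "\<Union>\<A> \<subseteq> S1"
    using A.subsets by auto
  then have "A.hull_of (\<Union>\<A>) \<in> L1"
    by (rule A.hull_of_closed)
  then have "polar_map L1 S2 R (A.hull_of (\<Union>\<A>)) = {q \<in> S2. A.hull_of (\<Union>\<A>) \<subseteq> R\<inverse> `` {q}}"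
    by (simp add: polar_map_def)
  also have "\<dots> = {q \<in> S2. \<Union>\<A> \<subseteq> R\<inverse> `` {q}}"
    using R by (intro Collect_cong conj_cong A.hull_of_subset_iff) (auto simp: closure_tensor_iff)
  also have "\<dots> = S2 \<inter> (\<Inter>a\<in>\<A>. {q \<in> S2. a \<subseteq> R\<inverse> `` {q}})"
    by blast
  also have "\<dots> = S2 \<inter> (\<Inter>a\<in>\<A>. polar_map L1 S2 R a)"
    using \<A> by (auto simp: polar_map_def)
  finally show "polar_map L1 S2 R (A.hull_of (\<Union>\<A>)) = S2 \<inter> (\<Inter>a\<in>\<A>. polar_map L1 S2 R a)" .
qed

text \<open>A subset of \<open>S1\<close> is the union of the singletons of its points, so its closure is
  the join of these atoms.\<close>

lemma join_map_hull_of: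
  assumes f: "f \<in> carrier join_maps" and a: "a \<subseteq> S1"
  shows "f (A.hull_of a) = S2 \<inter> (\<Inter>p\<in>a. f {p})"
proof -
  have "(\<lambda>p. {p}) ` a \<subseteq> L1"
    using a A.singleton_closed by auto
  then have "f (A.hull_of (\<Union>((\<lambda>p. {p}) ` a))) = S2 \<inter> (\<Inter>b\<in>(\<lambda>p. {p}) ` a. f b)"
    using f unfolding carrier_join_map_order_iff[OF spaces] by blast
  then show ?thesis by simp
qed

text \<open>For a column \<open>a\<close> at \<open>q\<close>, the value of \<open>f\<close> at the closure of \<open>a\<close> is the intersection of
  the values at the points of \<open>a\<close>, and so contains \<open>q\<close>. It is also the intersection of the values
  at the points of the closure itself, so each of these points lies in the column.\<close>

lemma atom_relation_in_tensor:
  assumes f: "f \<in> carrier join_maps"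
  shows "atom_relation S1 f \<in> tensor"
  unfolding closure_tensor_iff
proof (intro conjI ballI)
  have f_closed: "f {p} \<in> L2" if "p \<in> S1" for p
    using f A.singleton_closed[OF that] by (auto simp: carrier_join_map_order_iff[OF spaces])
  then show "atom_relation S1 f \<subseteq> S1 \<times> S2"
    using B.subsets by (auto simp: atom_relation_def)
  show "atom_relation S1 f `` {p} \<in> L2" if "p \<in> S1" for p
  proof -
    have "atom_relation S1 f `` {p} = f {p}"
      using that by (auto simp: atom_relation_def)
    then show ?thesis
      using f_closed[OF that] by simp
  qed
  show "(atom_relation S1 f)\<inverse> `` {q} \<in> L1" if "q \<in> S2" for q
  proof -
    define a where "a = (atom_relation S1 f)\<inverse> `` {q}"
    have a_eq: "a = {p \<in> S1. q \<in> f {p}}"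
      by (auto simp: a_def atom_relation_def)
    then have sub: "a \<subseteq> S1"
      by auto
    have closed: "A.hull_of a \<in> L1"
      using sub by (rule A.hull_of_closed)
    then have hull_sub: "A.hull_of a \<subseteq> S1"
      using A.subsets by auto
    have "q \<in> f (A.hull_of a)"
      using join_map_hull_of[OF f sub] that by (auto simp: a_eq)
    also have "f (A.hull_of a) = S2 \<inter> (\<Inter>p\<in>A.hull_of a. f {p})"
      using join_map_hull_of[OF f hull_sub] A.hull_of_eq[OF closed] by simp
    finally have "A.hull_of a \<subseteq> a"
      using hull_sub by (auto simp: a_eq)
    then have "A.hull_of a = a"
      using A.hull_of_superset by blast
    then show ?thesis
      using closed by (simp add: a_def)
  qed
qed

lemma atom_relation_polar_map:
  assumes "R \<in> tensor"
  shows "atom_relation S1 (polar_map L1 S2 R) = R"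
proof -
  have "atom_relation S1 (polar_map L1 S2 R) = Sigma S1 (\<lambda>p. R `` {p})"
    using polar_map_atom[OF assms] unfolding atom_relation_def by auto
  also have "\<dots> = R"
    using assms by (auto simp: closure_tensor_iff)
  finally show ?thesis .
qed

lemma polar_map_atom_relation:
  assumes f: "f \<in> carrier join_maps"
  shows "polar_map L1 S2 (atom_relation S1 f) = f"
proof
  fix a show "polar_map L1 S2 (atom_relation S1 f) a = f a"
  proof (cases "a \<in> L1")
    case True
    then have a: "a \<subseteq> S1"
      using A.subsets by auto
    then have "polar_map L1 S2 (atom_relation S1 f) a = S2 \<inter> (\<Inter>p\<in>a. f {p})"
      using True by (auto simp: polar_map_def atom_relation_def)
    also have "\<dots> = f a"
      using join_map_hull_of[OF f a] A.hull_of_eq[OF True] by simp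
    finally show ?thesis .
  next
    case False
    have "f \<in> L1 \<rightarrow>\<^sub>E L2"
      using f by (simp add: carrier_join_map_order_iff[OF spaces])
    then show ?thesis
      using False by (simp add: polar_map_def PiE_arb[of f L1])
  qed
qed

lemma bij_betw_polar_map: "bij_betw (polar_map L1 S2) tensor (carrier join_maps)"
  by (rule bij_betw_byWitness[where f' = "atom_relation S1"])
    (auto simp: atom_relation_polar_map polar_map_atom_relation
      polar_map_in_join_maps atom_relation_in_tensor)

lemma le_join_maps_iff:
  "f \<sqsubseteq>\<^bsub>join_maps\<^esub> g \<longleftrightarrow> atom_relation S1 g \<subseteq> atom_relation S1 f"
  by (auto simp: join_map_order_def closure_order_def atom_relation_def)

text \<open>Antisymmetry of the order on atoms is the fact that a join preserving map is
  recovered from its values on atoms.\<close>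

lemma partial_order_join_maps: "partial_order join_maps"
proof (rule partial_order.intro)
  have eq: "eq join_maps = (=)"
    by (simp add: join_map_order_def)
  have antisym: "f = g"
    if "f \<in> carrier join_maps" "g \<in> carrier join_maps"
      "f \<sqsubseteq>\<^bsub>join_maps\<^esub> g" "g \<sqsubseteq>\<^bsub>join_maps\<^esub> f" for f g
    using that polar_map_atom_relation unfolding le_join_maps_iff
    by (metis subset_antisym)
  show "weak_partial_order join_maps"
    by unfold_locales (use antisym in \<open>auto simp: eq le_join_maps_iff\<close>)
  show "partial_order_axioms join_maps"
    by unfold_locales (simp add: eq)
qed

proposition order_isomorphic_join_maps:
  "order_isomorphic (inv_gorder (closure_order tensor)) join_maps"
proof -
  interpret T: simple_closure_space "S1 \<times> S2" tensor
    by (rule simple_closure_space_closure_tensor[OF spaces])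
  interpret dual: complete_lattice "inv_gorder (closure_order tensor)"
    by (rule T.complete_lattice_inv_closure_order)
  interpret J: partial_order join_maps
    by (rule partial_order_join_maps)
  have "polar_map L1 S2 R \<sqsubseteq>\<^bsub>join_maps\<^esub> polar_map L1 S2 R' \<longleftrightarrow>
      R \<sqsubseteq>\<^bsub>inv_gorder (closure_order tensor)\<^esub> R'"
    if "R \<in> tensor" "R' \<in> tensor" for R R'
    unfolding le_join_maps_iff using that
    by (simp add: atom_relation_polar_map) (simp add: closure_order_def)
  moreover have "carrier (inv_gorder (closure_order tensor)) = tensor"
    by (simp add: closure_order_def)
  ultimately have "order_emb (inv_gorder (closure_order tensor)) join_maps (polar_map L1 S2)"
    unfolding order_emb_def
    using dual.weak_partial_order_axioms J.weak_partial_order_axioms by metis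
  moreover have "bij_betw (polar_map L1 S2) (carrier (inv_gorder (closure_order tensor)))
      (carrier join_maps)"
    using bij_betw_polar_map by (simp add: closure_order_def)
  ultimately show ?thesis
    unfolding order_isomorphic_def by blast
qed

end

section \<open>Both descriptions of the tensor product\<close>

theorem theorem3p18:
  fixes S1 :: "'a set" and L1 :: "'a set set" and S2 :: "'b set" and L2 :: "'b set set"
  assumes "simple_closure_space S1 L1" and "simple_closure_space S2 L2"
  shows "chu_isomorphic
           (closure_chu (S1 \<times> S2) (closure_tensor S1 L1 S2 L2))
           (chu_tensor (closure_chu S1 L1) (closure_chu S2 L2))
       \<and> order_isomorphic
           (inv_gorder (closure_order (closure_tensor S1 L1 S2 L2)))
           (join_map_order S1 L1 (inv_gorder (closure_order L2)))"
proof
  show "chu_isomorphic (closure_chu (S1 \<times> S2) (closure_tensor S1 L1 S2 L2))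
      (chu_tensor (closure_chu S1 L1) (closure_chu S2 L2))"
    using assms by (intro chu_isomorphic_closure_tensor simple_closure_space.subsets)
  show "order_isomorphic (inv_gorder (closure_order (closure_tensor S1 L1 S2 L2)))
      (join_map_order S1 L1 (inv_gorder (closure_order L2)))"
    using assms by (rule order_isomorphic_join_maps)
qed

end
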